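(* Let $H$ satisfy the standing assumptions (H). For $\mu>0$ and $m\in\mathscr C^{1,2}_{\mathrm{per}}((0,T)\times\mathbb T^d)$ let $\lambda_H(m,\mu)$ be the eigenvalue of $\partial_t+\mu(-\Delta+H(\nabla_x\cdot))+m$. Then there exists $m\in\mathscr C^{1,2}_{\mathrm{per}}((0,T)\times\mathbb T^d)$ such that $\mu\mapsto\lambda_H(m,\mu)$ is not monotonic on $(0,\infty)$.
   Context: $\mathbb T^d$ is the $d$-dimensional torus and $T>0$ is fixed. $\mathscr C^{1,2}_{\mathrm{per}}((0,T)\times\mathbb T^d)$ denotes functions that are $T$-periodic in $t$, $\mathbb T^d$-periodic in $x$, $\mathscr C^1$ in $t$ and $\mathscr C^2$ in $x$. Standing assumptions (H) on $H:\mathbb R^d\to\mathbb R$: $H$ is $\mathscr C^2$; $H(p)>H(0)=0$ for $p\neq0$; $\nabla^2_{pp}H(p)$ is symmetric positive definite for $p\neq 0$; there is a continuous, coercive, convex, non-negative function $\mathcal H$ on $[0,\infty)$ with $\mathcal H(a)>\mathcal H(0)=0$ for $a>0$ such that $\mathcal H\big(\|f-\frac{1}{|\mathbb T^d|}\int_{\mathbb T^d}f\|_{L^1(\mathbb T^d)}\big)\le\int_{\mathbb T^d}H(\nabla f)$ for every $f\in\mathscr C^2(\mathbb T^d)$; and there is $\beta\in(0,1)$ with $aH(p)\ge H(a^\beta p)$ for all $a\in(0,1)$, $p\in\mathbb R^d$. Eigenvalue: the eigenvalue of $\partial_t+\mu(-\Delta+H(\nabla_x\cdot))+m$ is the unique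 real $\lambda$ for which there exists $\varphi\in\mathscr C^{1,2}_{\mathrm{per}}((0,T)\times\mathbb T^d)$ with $\lambda+\partial_t\varphi+\mu(-\Delta\varphi+H(\nabla_x\varphi))=-m$. *)

theory Defs
  imports "HOL-Analysis.Analysis"
begin

text \<open>The torus T^d is realised as R^d / Z^d (period 1 in each coordinate);
  its fundamental domain is the unit cube cbox 0 One, of volume 1.
  The dimension d is the cardinality of the finite index type 'd.\<close>

definition per_x :: "(real^'d::finite \<Rightarrow> real) \<Rightarrow> bool" where
  "per_x f \<equiv> \<forall>x::real^'d. \<forall>i. f (x + axis i 1) = f x"

definition pdiff :: "'d::finite \<Rightarrow> (real^'d \<Rightarrow> real) \<Rightarrow> real^'d \<Rightarrow> real" where
  "pdiff i g x = deriv (\<lambda>h. g (x + h *\<^sub>R axis i 1)) 0"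

definition grad :: "(real^'d::finite \<Rightarrow> real) \<Rightarrow> real^'d \<Rightarrow> real^'d" where
  "grad g x = (\<chi> i. pdiff i g x)"

definition lapl :: "(real^'d::finite \<Rightarrow> real) \<Rightarrow> real^'d \<Rightarrow> real" where
  "lapl g x = (\<Sum>i\<in>UNIV. pdiff i (pdiff i g) x)"

definition dt :: "(real \<Rightarrow> real^'d::finite \<Rightarrow> real) \<Rightarrow> real \<Rightarrow> real^'d \<Rightarrow> real" where
  "dt f t x = deriv (\<lambda>s. f s x) t"

definition C2 :: "(real^'d::finite \<Rightarrow> real) \<Rightarrow> bool" where
  "C2 f \<equiv> \<exists>g h. (\<forall>x. (f has_derivative (\<lambda>v. g x \<bullet> v)) (at x))
     \<and> (\<forall>x. (g has_derivative (\<lambda>v. h x *v v)) (at x))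
     \<and> continuous_on UNIV g \<and> continuous_on UNIV (h :: real^'d \<Rightarrow> real^'d^'d)"

definition C2per :: "(real^'d::finite \<Rightarrow> real) \<Rightarrow> bool" where
  "C2per f \<equiv> C2 f \<and> per_x f"

definition C12per :: "real \<Rightarrow> (real \<Rightarrow> real^'d::finite \<Rightarrow> real) \<Rightarrow> bool" where
  "C12per T f \<equiv> (\<forall>t x. f (t + T) x = f t x) \<and> (\<forall>t. per_x (f t)) \<and>
     (\<exists>ft g h.
        (\<forall>t x. ((\<lambda>s. f s x) has_real_derivative ft t x) (at t))
      \<and> (\<forall>t x. (f t has_derivative (\<lambda>v. g t x \<bullet> v)) (at x))
      \<and> (\<forall>t x. (g t has_derivative (\<lambda>v. h t x *v v)) (at x))
      \<and> continuous_on UNIV (\<lambda>(t,x). ft t x)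
      \<and> continuous_on UNIV (\<lambda>(t,x). g t x)
      \<and> continuous_on UNIV (\<lambda>(t,x). (h t x :: real^'d^'d)))"

definition assumption_H :: "(real^'d::finite \<Rightarrow> real) \<Rightarrow> bool" where
  "assumption_H H \<equiv>
     C2 H \<and> H 0 = 0 \<and> (\<forall>p. p \<noteq> 0 \<longrightarrow> H p > 0) \<and>
     (\<exists>Hess :: real^'d \<Rightarrow> real^'d^'d.
        (\<forall>p. ((\<lambda>q. grad H q) has_derivative (\<lambda>v. Hess p *v v)) (at p)) \<and>
        (\<forall>p. p \<noteq> 0 \<longrightarrow> transpose (Hess p) = Hess p \<and>
              (\<forall>v. v \<noteq> 0 \<longrightarrow> v \<bullet> (Hess p *v v) > 0))) \<and>
     (\<exists>HH :: real \<Rightarrow> real.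
        continuous_on {0..} HH \<and> filterlim HH at_top at_top \<and>
        convex_on {0..} HH \<and> (\<forall>a\<ge>0. HH a \<ge> 0) \<and> HH 0 = 0 \<and>
        (\<forall>a>0. HH a > 0) \<and>
        (\<forall>f. C2per f \<longrightarrow>
           HH (integral (cbox 0 One) (\<lambda>x. \<bar>f x - integral (cbox 0 One) f / Henstock_Kurzweil_Integration.content (cbox (0::real^'d) One)\<bar>))
             \<le> integral (cbox 0 One) (\<lambda>x. H (grad f x)))) \<and>
     (\<exists>\<beta>. 0 < \<beta> \<and> \<beta> < 1 \<and>
        (\<forall>a p. 0 < a \<and> a < 1 \<longrightarrow> a * H p \<ge> H ((a powr \<beta>) *\<^sub>R p)))"

definition is_eigenvalue ::
  "real \<Rightarrow> (real^'d::finite \<Rightarrow> real) \<Rightarrow> (real \<Rightarrow> real^'d \<Rightarrow> real) \<Rightarrow> real \<Rightarrow> real \<Rightarrow> bool" where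
  "is_eigenvalue T H m \<mu> lam \<equiv> \<exists>\<phi>. C12per T \<phi> \<and>
     (\<forall>t x. lam + dt \<phi> t x + \<mu> * (- lapl (\<phi> t) x + H (grad (\<phi> t) x)) = - m t x)"

definition eigenvalue_H ::
  "real \<Rightarrow> (real^'d::finite \<Rightarrow> real) \<Rightarrow> (real \<Rightarrow> real^'d \<Rightarrow> real) \<Rightarrow> real \<Rightarrow> real" where
  "eigenvalue_H T H m \<mu> = (THE lam. is_eigenvalue T H m \<mu> lam)"

end

theory Submission
  imports Defs
begin

text \<open>Fix a coordinate \<open>i\<close> and put \<open>c = 1 / T\<close>. A travelling wave \<open>\<phi>(t,x) = w(x\<^sub>i - c t)\<close> with
  \<open>w\<close> of period 1 is \<open>T\<close>-periodic in time, and with \<open>v = w'\<close>, \<open>h(q) = H(q e\<^sub>i)\<close> and potential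
  \<open>m(t,x) = g(x\<^sub>i - c t)\<close> the eigenvalue equation becomes
  \<open>\<lambda> - c v + \<mu> (- v' + h(v)) = - g\<close> for a periodic \<open>v\<close> of mean zero; so
  \<open>\<lambda> = - \<integral>g - \<mu> \<integral>h(v)\<close>. Choose \<open>g\<close> such that \<open>v = sin(2\<pi>s)\<close> is a solution for \<open>\<mu> = 1\<close> with
  \<open>\<lambda> = 0\<close>; then \<open>- \<integral>g > 0\<close>. For small \<open>\<mu>\<close> and for large \<open>\<mu>\<close> a solution is found by
  contraction, with \<open>\<mu> h(v)\<close> so small (bounded \<open>v\<close> in the first case; \<open>v = O(1/\<mu>)\<close> and \<open>h(q) = o(q)\<close>
  in the second) that \<open>\<lambda> > 0\<close>. Uniqueness of the eigenvalue among all \<open>\<phi>\<close>, not just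
  waves, follows from the maximum principle.\<close>

section \<open>Periodic solutions of a linear equation\<close>

definition per1 :: "(real \<Rightarrow> real) \<Rightarrow> bool" where
  "per1 f \<longleftrightarrow> (\<forall>s. f (s + 1) = f s)"

lemma per1_of_nat: "per1 f \<Longrightarrow> f (s + of_nat n) = f s"
proof (induction n)
  case (Suc n)
  have "f (s + of_nat (Suc n)) = f ((s + of_nat n) + 1)" by (simp add: algebra_simps)
  then show ?case using Suc by (simp add: per1_def)
qed simp

lemma per1_of_int: assumes "per1 f" shows "f (s + of_int k) = f s"
proof (cases "k \<ge> 0")
  case True
  then show ?thesis using per1_of_nat[OF assms, of s "nat k"] by simp
next
  case False
  then show ?thesis using per1_of_nat[OF assms, of "s + of_int k" "nat (- k)"] by simp
qed

lemma per1_frac: "per1 f \<Longrightarrow> f (frac s) = f s"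
  using per1_of_int[of f s "- \<lfloor>s\<rfloor>"] by (simp add: frac_def)

lemma per1_attains_max:
  assumes "per1 f" "continuous_on UNIV f"
  obtains z where "\<And>s. f s \<le> f z"
proof -
  obtain z where "z \<in> {0..1}" and z: "\<forall>s\<in>{0..1}. f s \<le> f z"
    using continuous_attains_sup[of "{0..1::real}" f] continuous_on_subset[OF assms(2)] by auto
  have "f s \<le> f z" for s
    using z[rule_format, of "frac s"] per1_frac[OF assms(1), of s] frac_lt_1[of s]
    by (auto simp: less_imp_le)
  then show ?thesis using that by blast
qed

lemma per1_bounded:
  assumes "per1 f" "continuous_on UNIV f"
  obtains B where "B > 0" "\<And>s. \<bar>f s\<bar> \<le> B"
proof -
  have "per1 (\<lambda>s. \<bar>f s\<bar>)" using assms(1) by (simp add: per1_def)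
  moreover have "continuous_on UNIV (\<lambda>s. \<bar>f s\<bar>)" by (intro continuous_intros assms)
  ultimately obtain z where "\<And>s. \<bar>f s\<bar> \<le> \<bar>f z\<bar>" using per1_attains_max by blast
  then have "\<bar>f s\<bar> \<le> \<bar>f z\<bar> + 1" for s by (meson add_increasing2 zero_le_one)
  moreover have "\<bar>f z\<bar> + 1 > 0" by linarith
  ultimately show ?thesis using that by blast
qed

lemma has_antiderivative:
  fixes f :: "real \<Rightarrow> real"
  assumes "continuous_on UNIV f"
  obtains F where "\<And>s. (F has_real_derivative f s) (at s)"
proof -
  have "\<exists>F. \<forall>x::real. -\<infinity> < ereal x \<longrightarrow> ereal x < \<infinity> \<longrightarrow> (F has_vector_derivative f x) (at x)"
    using assms by (intro einterval_antiderivative) (auto simp: continuous_on_eq_continuous_at)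
  then show ?thesis using that by (auto simp: has_real_derivative_iff_has_vector_derivative)
qed

lemma DERIV_imp_continuous_on:
  "(\<And>s. (f has_real_derivative f' s) (at s)) \<Longrightarrow> continuous_on S f"
  by (meson DERIV_isCont continuous_at_imp_continuous_on)

lemma DERIV_zero_UNIV:
  fixes f :: "real \<Rightarrow> real"
  assumes "\<And>s. (f has_real_derivative 0) (at s)"
  shows "f s = f t"
  using DERIV_isconst_all assms by blast

text \<open>At an extremum of \<open>v\<close> the derivative vanishes, so that \<open>c * v = f\<close> there.\<close>

lemma per1_ode_bound:
  fixes v v' f :: "real \<Rightarrow> real"
  assumes "c > 0" "per1 v" and d: "\<And>s. (v has_real_derivative v' s) (at s)"
    and eq: "\<And>s. \<mu> * v' s + c * v s = f s" and B: "\<And>s. \<bar>f s\<bar> \<le> B"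
  shows "\<bar>v s\<bar> \<le> B / c"
proof -
  \<comment> \<open>Only an upper bound can be read off a maximum; it is stated for any periodic
    \<open>u\<close> so that it applies to both \<open>v\<close> and \<open>- v\<close>.\<close>
  have up: "u s \<le> B / c"
    if per: "per1 u" and "\<And>s. (u has_real_derivative u' s) (at s)" and "\<And>s. \<mu> * u' s + c * u s \<le> B"
    for u u' s
  proof -
    have "continuous_on UNIV u"
      using that(2) by (rule DERIV_imp_continuous_on)
    then obtain z where z: "\<And>s. u s \<le> u z" using per1_attains_max[OF per] by blast
    have "u' z = 0" using DERIV_local_max[OF that(2)[of z], of 1] z by auto
    then have "c * u z \<le> B" using that(3)[of z] by simp
    then have "u z \<le> B / c" using \<open>c > 0\<close> by (simp add: field_simps)
    then show ?thesis using z[of s] by linarith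
  qed
  have "v s \<le> B / c"
    by (rule up[OF \<open>per1 v\<close> d]) (use eq B in \<open>smt (verit)\<close>)
  moreover have "- v s \<le> B / c"
  proof (rule up[of "\<lambda>s. - v s" "\<lambda>s. - v' s"])
    show "\<mu> * - v' s + c * - v s \<le> B" for s using eq[of s] B[of s] by (simp add: algebra_simps)
  qed (use \<open>per1 v\<close> d in \<open>auto simp: per1_def intro!: derivative_eq_intros\<close>)
  ultimately show ?thesis by simp
qed

text \<open>By Rolle's theorem the mean-zero \<open>v\<close> vanishes within distance one of every point.\<close>

lemma per1_mean_zero_ode_bound:
  fixes v v' f :: "real \<Rightarrow> real"
  assumes "c > 0" "\<mu> > 0" "per1 v" and d: "\<And>s. (v has_real_derivative v' s) (at s)"
    and eq: "\<And>s. \<mu> * v' s + c * v s = f s" and B: "\<And>s. \<bar>f s\<bar> \<le> B"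
    and "per1 w" and w: "\<And>s. (w has_real_derivative v s) (at s)"
  shows "\<bar>v s\<bar> \<le> 2 * B / \<mu>"
proof -
  have "\<exists>z>s. z < s + 1 \<and> (w has_real_derivative 0) (at z)"
  proof (rule Rolle)
    show "w s = w (s + 1)" using \<open>per1 w\<close> by (simp add: per1_def)
    show "continuous_on {s..s + 1} w" using w by (rule DERIV_imp_continuous_on)
  qed (use w in \<open>auto simp: real_differentiable_def\<close>)
  then obtain z where z: "s < z" "z < s + 1" "v z = 0"
    using w DERIV_unique by blast
  \<comment> \<open>The bound by \<open>B / c\<close> gives |c v| \<le> B, hence |\<mu> v'| = |f - c
    v| \<le> 2 B. Starting from the zero \<open>z\<close>, less than one away, this slope bound
    controls \<open>v s\<close>.\<close>
  have b: "\<bar>v' r\<bar> \<le> 2 * B / \<mu>" for r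
  proof -
    have "c * \<bar>v r\<bar> \<le> B"
      using per1_ode_bound[OF assms(1,3) d eq B, of r] \<open>c > 0\<close> by (simp add: field_simps)
    then have "\<bar>c * v r\<bar> \<le> B" using \<open>c > 0\<close> by (simp add: abs_mult)
    then have "\<bar>\<mu> * v' r\<bar> \<le> 2 * B" using eq[of r] B[of r] by linarith
    then show ?thesis using \<open>\<mu> > 0\<close> by (simp add: abs_mult field_simps)
  qed
  have "\<bar>v s - v z\<bar> \<le> 2 * B / \<mu> * \<bar>s - z\<bar>"
    using field_differentiable_bound[of UNIV v v' "2 * B / \<mu>" s z] d b by simp
  also have "\<dots> \<le> 2 * B / \<mu> * 1"
    using z b[of 0] by (intro mult_left_mono) (auto intro: order_trans[OF abs_ge_zero])
  finally show ?thesis using z by simp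
qed

text \<open>Variation of constants with \<open>k = c / \<mu>\<close>: integrate exp(k (r - s)) f(r)
  / \<mu> over all r \<le> s and fold the half-line onto the window [s - 1, s]. The geometric series
  produces the denominator \<open>1 - exp (- k)\<close>.\<close>

lemma per1_ode_exists:
  fixes f :: "real \<Rightarrow> real"
  assumes "c > 0" "\<mu> > 0" "per1 f" "continuous_on UNIV f"
  obtains v where "per1 v" "\<And>s. (v has_real_derivative ((f s - c * v s) / \<mu>)) (at s)"
proof -
  define k where "k = c / \<mu>"
  have k: "k > 0" using assms by (simp add: k_def)
  have "continuous_on UNIV (\<lambda>s. exp (k * s) * f s / \<mu>)"
    using assms by (intro continuous_intros) auto
  then obtain A where A: "\<And>s. (A has_real_derivative (exp (k * s) * f s / \<mu>)) (at s)"
    using has_antiderivative by blast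
  have A1: "((\<lambda>s. A (s + 1)) has_real_derivative (exp (k * (s + 1)) * f (s + 1) / \<mu>)) (at s)" for s
    using A[of "s + 1"] DERIV_shift by blast
  have A2: "((\<lambda>s. A (s - 1)) has_real_derivative (exp (k * (s - 1)) * f (s - 1) / \<mu>)) (at s)" for s
    using A[of "s - 1"] DERIV_shift[of A _ s "-1"] by simp
  have fper: "f (s + 1) = f s" "f (s - 1) = f s" for s
    using assms(3) unfolding per1_def by (auto, metis diff_add_cancel)
  \<comment> \<open>As \<open>f\<close> has period one, the integrand at \<open>s + 1\<close> is
    \<open>exp k\<close> times the one at \<open>s\<close>, so this difference is constant; equating
    its values at \<open>s\<close> and \<open>s - 1\<close> gives the periodicity of
    \<open>v\<close>.\<close>
  have "((\<lambda>s. A (s + 1) - exp k * A s) has_real_derivative 0) (at s)" for s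
    by (rule derivative_eq_intros A1 A refl)+ (simp add: fper exp_add distrib_left)
  then have D: "A (s + 1) - exp k * A s = A s - exp k * A (s - 1)" for s
    using DERIV_zero_UNIV[of "\<lambda>s. A (s + 1) - exp k * A s" s "s - 1"] by simp
  define v where "v s = exp (- k * s) * (A s - A (s - 1)) / (1 - exp (- k))" for s
  have ek: "1 - exp (- k) \<noteq> 0" using k by simp
  have "per1 v"
  proof -
    have *: "A (s + 1) - A s = exp k * (A s - A (s - 1))" for s
      using D[of s] by (simp add: algebra_simps)
    have "exp (- k * (s + 1)) * exp k = exp (- k * s)" for s
      by (simp add: exp_add[symmetric] algebra_simps)
    then have "exp (- k * (s + 1)) * (exp k * y) = exp (- k * s) * y" for s y
      by (metis mult.assoc)
    then have "exp (- k * (s + 1)) * (A (s + 1) - A (s + 1 - 1)) = exp (- k * s) * (A s - A (s - 1))" for s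
      unfolding add_diff_cancel_right' * by blast
    then show ?thesis unfolding per1_def v_def by presburger
  qed
  moreover have "(v has_real_derivative ((f s - c * v s) / \<mu>)) (at s)" for s
  proof -
    have "(v has_real_derivative
       (((- k) * exp (- k * s)) * (A s - A (s - 1)) + (exp (k * s) * f s / \<mu> - exp (k * (s - 1)) * f (s - 1) / \<mu>) * exp (- k * s)) / (1 - exp (- k))) (at s)"
      unfolding v_def by (rule DERIV_cdivide) (rule derivative_eq_intros A A2 refl | simp)+
    moreover have "(exp (k * s) * f s / \<mu> - exp (k * (s - 1)) * f (s - 1) / \<mu>) * exp (- k * s) = f s / \<mu> * (1 - exp (- k))"
    proof -
      have "exp (k * s) * exp (- k * s) = 1" "exp (k * (s - 1)) * exp (- k * s) = exp (- k)"
        by (simp_all add: exp_add[symmetric] algebra_simps)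
      moreover have "(a * y / \<mu> - b * y / \<mu>) * e = y / \<mu> * (a * e - b * e)" for a b y e
        by (simp add: algebra_simps diff_divide_distrib)
      ultimately show ?thesis by (simp add: fper)
    qed
    ultimately show ?thesis
      using ek \<open>\<mu> > 0\<close> by (simp add: v_def k_def diff_divide_distrib add_divide_distrib mult_ac)
  qed
  ultimately show ?thesis using that by blast
qed

text \<open>\<open>F (s + 1) - F s\<close> is constant because \<open>f\<close> is periodic, and its
  value at 0 is the integral of \<open>f\<close> over one period.\<close>

lemma per1_antiderivative:
  fixes f :: "real \<Rightarrow> real"
  assumes "per1 f" "continuous_on UNIV f" "integral {0..1} f = 0"
  obtains F where "per1 F" "\<And>s. (F has_real_derivative f s) (at s)"
proof -
  obtain F where F: "\<And>s. (F has_real_derivative f s) (at s)"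
    using has_antiderivative assms by blast
  have "(f has_integral (F 1 - F 0)) {0..1}"
    using F by (intro fundamental_theorem_of_calculus)
      (auto simp: has_real_derivative_iff_has_vector_derivative[symmetric] intro: has_field_derivative_at_within)
  then have F01: "F 1 = F 0" using assms(3) by (simp add: integral_unique)
  have F1: "((\<lambda>s. F (s + 1)) has_real_derivative f s) (at s)" for s
    using F[of "s + 1"] DERIV_shift[of F] assms(1) by (simp add: per1_def)
  have "((\<lambda>s. F (s + 1) - F s) has_real_derivative 0) (at s)" for s
    by (rule derivative_eq_intros F F1)+ simp
  then have "F (s + 1) - F s = F (0 + 1) - F 0" for s
    using DERIV_zero_UNIV[of "\<lambda>s. F (s + 1) - F s" s 0] by simp
  then have "per1 F" using F01 by (simp add: per1_def)
  then show ?thesis using F that by blast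
qed

section \<open>Travelling waves by contraction\<close>

text \<open>Banach's fixed point theorem applies to \<open>v = R (P (g + \<mu> * h(v)))\<close>, where \<open>P\<close> subtracts
  the mean and \<open>R\<close> inverts \<open>\<mu> * v' + c * v\<close> on periodic functions. The two choices of \<open>N\<close>
  are the two bounds for \<open>R\<close> above, effective for small and for large \<open>\<mu>\<close>; \<open>lam\<close> is minus the
  mean of \<open>g + \<mu> * h(v)\<close>.\<close>

lemma travelling_wave_exists:
  fixes g h :: "real \<Rightarrow> real"
  assumes c: "c > 0" and mu: "\<mu> > 0"
    and g: "per1 g" "continuous_on UNIV g" "\<And>s. \<bar>g s\<bar> \<le> G"
    and h: "continuous_on UNIV h" "h 0 = 0"
      "\<And>q q'. \<bar>q\<bar> \<le> r \<Longrightarrow> \<bar>q'\<bar> \<le> r \<Longrightarrow> \<bar>h q - h q'\<bar> \<le> L * \<bar>q - q'\<bar>"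
    and N: "N = 1 / c \<or> N = 2 / \<mu>"
    and L: "L \<ge> 0" and r: "r \<ge> 0"
    and contr: "2 * N * \<mu> * L < 1" and self: "2 * N * (G + \<mu> * L * r) \<le> r"
  obtains w v v' lam where "per1 w" "\<And>s. (w has_real_derivative v s) (at s)"
    "\<And>s. (v has_real_derivative v' s) (at s)" "continuous_on UNIV v'"
    "\<And>s. lam - c * v s + \<mu> * (- v' s + h (v s)) = - g s"
    "\<bar>lam + integral {0..1} g\<bar> \<le> \<mu> * L * r"
proof -
  have hb: "\<bar>h q\<bar> \<le> L * r" if "\<bar>q\<bar> \<le> r" for q
  proof -
    have "\<bar>h q\<bar> \<le> L * \<bar>q\<bar>" using h(3)[of q 0] that r h(2) by simp
    also have "\<dots> \<le> L * r" using that L by (intro mult_left_mono)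
    finally show ?thesis .
  qed
  have Npos: "N > 0" using N c mu by auto
  have mean_le: "\<bar>integral {0..1} u\<bar> \<le> B" if "continuous_on UNIV u" "\<And>s. \<bar>u s\<bar> \<le> B" for u :: "real \<Rightarrow> real" and B
  proof -
    have "norm (integral {0..1} u) \<le> B * (1 - 0)"
      by (rule integral_bound) (use that in \<open>auto intro: continuous_on_subset\<close>)
    then show ?thesis by simp
  qed
  define P where "P u s = u s - integral {0..1} u" for u :: "real \<Rightarrow> real" and s
  have P: "per1 (P u)" "continuous_on UNIV (P u)" "integral {0..1} (P u) = 0"
    if "per1 u" "continuous_on UNIV u" for u
  proof -
    show "per1 (P u)" using that by (simp add: per1_def P_def)
    show "continuous_on UNIV (P u)" unfolding P_def by (intro continuous_intros that)
    have "u integrable_on {0..1}" using that by (meson continuous_on_subset integrable_continuous_real subset_UNIV)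
    then show "integral {0..1} (P u) = 0"
      unfolding P_def by (subst integral_diff) auto
  qed
  have Pb: "\<bar>P u s\<bar> \<le> 2 * B" if "continuous_on UNIV u" "\<And>s. \<bar>u s\<bar> \<le> B" for u s B
    using mean_le[OF that] that(2)[of s] by (simp add: P_def)
  have Pdiff: "P u s - P u' s = P (\<lambda>s. u s - u' s) s"
    if "continuous_on UNIV u" "continuous_on UNIV u'" for u u' s
  proof -
    have "u integrable_on {0..1}" "u' integrable_on {0..1}"
      using that by (meson continuous_on_subset integrable_continuous_real subset_UNIV)+
    then show ?thesis unfolding P_def by (subst integral_diff) auto
  qed
  define sol where "sol f v \<longleftrightarrow> per1 v \<and> (\<forall>s. (v has_real_derivative ((f s - c * v s) / \<mu>)) (at s))"
    for f v :: "real \<Rightarrow> real"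
  have sol_ex: "\<exists>v. sol f v" if "per1 f" "continuous_on UNIV f" for f
    using per1_ode_exists[OF c mu that] unfolding sol_def by metis
  have sol_cont: "continuous_on UNIV v" if "sol f v" for f v
    using that unfolding sol_def by (intro DERIV_imp_continuous_on) auto
  \<comment> \<open>Integrating \<mu> v' + c v = f expresses an antiderivative of \<open>v\<close>
    as \<open>(F s - \<mu> * v s) / c\<close>, periodic because \<open>f\<close> has mean zero. It
    serves the Rolle bound and later as the wave profile.\<close>
  have sol_w: "\<exists>w. per1 w \<and> (\<forall>s. (w has_real_derivative v s) (at s))"
    if s: "sol f v" and f: "per1 f" "continuous_on UNIV f" "integral {0..1} f = 0" for f v
  proof -
    obtain F where F: "per1 F" "\<And>s. (F has_real_derivative f s) (at s)"
      using per1_antiderivative[OF f] by blast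
    have v: "per1 v" "\<And>s. (v has_real_derivative ((f s - c * v s) / \<mu>)) (at s)"
      using s by (auto simp: sol_def)
    have "((\<lambda>s. (F s - \<mu> * v s) / c) has_real_derivative v s) (at s)" for s
      using DERIV_cdivide[OF DERIV_diff[OF F(2)[of s] DERIV_cmult[OF v(2)[of s], of \<mu>]], of c] c mu
      by simp
    moreover have "per1 (\<lambda>s. (F s - \<mu> * v s) / c)" using F v by (simp add: per1_def)
    ultimately show ?thesis by blast
  qed
  have sol_bound: "\<bar>v s\<bar> \<le> N * B"
    if s: "sol f v" and f: "per1 f" "continuous_on UNIV f" "integral {0..1} f = 0"
      and B: "\<And>s. \<bar>f s\<bar> \<le> B" for f v s B
  proof -
    have v: "per1 v" "\<And>s. (v has_real_derivative ((f s - c * v s) / \<mu>)) (at s)"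
      using s by (auto simp: sol_def)
    have eq: "\<mu> * ((f s - c * v s) / \<mu>) + c * v s = f s" for s using mu by simp
    obtain w where w: "per1 w" "\<And>s. (w has_real_derivative v s) (at s)" using sol_w[OF s f] by blast
    show ?thesis
      using N per1_ode_bound[OF c v eq B, of s] per1_mean_zero_ode_bound[OF c mu v eq B w, of s] by auto
  qed
  have sol_diff: "sol (\<lambda>s. f s - f' s) (\<lambda>s. v s - v' s)" if "sol f v" "sol f' v'" for f f' v v'
  proof -
    have v: "\<And>s. (v has_real_derivative ((f s - c * v s) / \<mu>)) (at s)"
      "\<And>s. (v' has_real_derivative ((f' s - c * v' s) / \<mu>)) (at s)"
      using that by (auto simp: sol_def)
    have "((\<lambda>s. v s - v' s) has_real_derivative ((f s - f' s - c * (v s - v' s)) / \<mu>)) (at s)" for s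
      by (rule derivative_eq_intros v refl)+ (simp add: diff_divide_distrib add_divide_distrib algebra_simps)
    then show ?thesis using that by (auto simp: sol_def per1_def)
  qed
  define F where "F v s = g s + \<mu> * h (v s)" for v :: "real \<Rightarrow> real" and s
  have Fcont: "continuous_on UNIV (F v)" if "continuous_on UNIV v" for v
    unfolding F_def using that
    by (intro continuous_intros g continuous_on_compose2[OF h(1)]) auto
  have Fper: "per1 (F v)" if "per1 v" for v using that g by (simp add: per1_def F_def)
  have Fb: "\<bar>F v s\<bar> \<le> G + \<mu> * L * r" if "\<And>s. \<bar>v s\<bar> \<le> r" for v s
  proof -
    have "\<bar>\<mu> * h (v s)\<bar> \<le> \<mu> * (L * r)" using hb[OF that] mu by (simp add: abs_mult)
    then show ?thesis using g(3)[of s] by (simp add: F_def mult.assoc)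
  qed
  \<comment> \<open>On this ball \<open>h\<close> is evaluated only in [-r, r], where its Lipschitz
    constant \<open>L\<close> is available.\<close>
  define S :: "(real \<Rightarrow>\<^sub>C real) set" where "S = {v. per1 (apply_bcontfun v) \<and> (\<forall>s. \<bar>v s\<bar> \<le> r)}"
  \<comment> \<open>Any solution may be chosen, since \<open>sol_bound\<close> holds for all of
    them.\<close>
  define R where "R f = (SOME v. sol (P f) v)" for f
  define \<Phi> where "\<Phi> v = Bcontfun (R (F (apply_bcontfun v)))" for v
  have R: "sol (P (F v)) (R (F v))" if "per1 v" "continuous_on UNIV v" for v
    using someI_ex[OF sol_ex[OF P(1,2)[OF Fper[OF that(1)] Fcont[OF that(2)]]]] by (simp add: R_def)
  have Rb: "\<bar>R (F v) s\<bar> \<le> r" if v: "per1 v" "continuous_on UNIV v" "\<And>s. \<bar>v s\<bar> \<le> r" for v s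
  proof -
    \<comment> \<open>Subtracting the mean at most doubles the sup norm and inverting the equation
      costs \<open>N\<close>; hence the factor \<open>2 * N\<close> in \<open>self\<close> and
      \<open>contr\<close>.\<close>
    have "\<bar>R (F v) s\<bar> \<le> N * (2 * (G + \<mu> * L * r))"
      by (rule sol_bound[OF R[OF v(1,2)]]) (use v P Fcont Fper Pb[OF Fcont Fb] in auto)
    also have "\<dots> = 2 * N * (G + \<mu> * L * r)" by (simp add: mult.left_commute)
    finally show ?thesis using self by linarith
  qed
  have \<Phi>: "apply_bcontfun (\<Phi> v) = R (F v)" if "v \<in> S" for v
  proof -
    have "per1 (apply_bcontfun v)" "\<And>s. \<bar>v s\<bar> \<le> r" using that by (auto simp: S_def)
    then have "R (F v) \<in> bcontfun"
      by (intro bcontfun_normI[where b = r]) (auto intro!: Rb sol_cont[OF R])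
    then show ?thesis by (simp add: \<Phi>_def Bcontfun_inverse)
  qed
  have "\<exists>!v\<in>S. \<Phi> v = v"
  proof (rule Banach_fix)
    show "complete S"
    proof -
      \<comment> \<open>Periodicity is one closed condition on evaluations for each
        \<open>s\<close>, so \<open>S\<close> is closed in the complete space of bounded continuous
        functions.\<close>
      have "S = PiC UNIV (\<lambda>_. {-r..r}) \<inter> (\<Inter>s. {v. apply_bcontfun v (s + 1) - apply_bcontfun v s = 0})"
        by (auto simp: S_def mem_PiC_iff Pi_iff per1_def abs_le_iff minus_le_iff[of r])
      moreover have ev: "continuous_on UNIV (\<lambda>v :: real \<Rightarrow>\<^sub>C real. v s)" for s :: real
        unfolding continuous_on_iff by (meson dist_fun_lt_imp_dist_val_lt)
      have "closed {v :: real \<Rightarrow>\<^sub>C real. v (s + 1) - v s = 0}" for s :: real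
        by (intro closed_Collect_eq continuous_intros ev)
      ultimately show ?thesis
        unfolding complete_eq_closed by (auto intro!: closed_Int closed_INT closed_PiC)
    qed
    have "0 \<in> S" using r by (simp add: S_def per1_def)
    then show "S \<noteq> {}" by auto
    show "0 \<le> 2 * N * \<mu> * L" using Npos mu L by simp
    show "\<Phi> ` S \<subseteq> S"
      using \<Phi> R Rb by (auto simp: S_def sol_def)
    show "dist (\<Phi> v) (\<Phi> v') \<le> 2 * N * \<mu> * L * dist v v'" if v: "v \<in> S" "v' \<in> S" for v v'
    proof (rule dist_bound)
      fix s
      have p: "per1 (apply_bcontfun v)" "per1 (apply_bcontfun v')"
        "\<And>s. \<bar>v s\<bar> \<le> r" "\<And>s. \<bar>v' s\<bar> \<le> r" using v by (auto simp: S_def)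
      have F: "\<bar>F v s - F v' s\<bar> \<le> \<mu> * L * dist v v'" for s
      proof -
        have "\<bar>F v s - F v' s\<bar> = \<mu> * \<bar>h (v s) - h (v' s)\<bar>"
          using mu by (simp add: F_def abs_mult right_diff_distrib[symmetric])
        also have "\<dots> \<le> \<mu> * (L * \<bar>v s - v' s\<bar>)"
          using h(3) p mu by (intro mult_left_mono) auto
        also have "\<dots> \<le> \<mu> * (L * dist v v')"
          using mu L dist_bounded[of v s v'] by (intro mult_left_mono) (auto simp: dist_real_def)
        finally show ?thesis by (simp add: mult.assoc)
      qed
      let ?d = "\<lambda>s. P (F v) s - P (F v') s"
      \<comment> \<open>By linearity the difference of two images solves the linear equation with
        this right-hand side, which turns \<open>sol_bound\<close> into a Lipschitz
        estimate.\<close>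
      have d: "?d = P (\<lambda>s. F v s - F v' s)" by (intro ext Pdiff Fcont) auto
      have D: "continuous_on UNIV (\<lambda>s. F v s - F v' s)" "per1 (\<lambda>s. F v s - F v' s)"
        using p Fper[of v] Fper[of v'] by (auto intro!: continuous_intros Fcont simp: per1_def)
      have "sol (P (\<lambda>s. F v s - F v' s)) (\<lambda>s. R (F v) s - R (F v') s)"
        using sol_diff[OF R[OF p(1)] R[OF p(2)]] d by simp
      then have "\<bar>R (F v) s - R (F v') s\<bar> \<le> N * (2 * (\<mu> * L * dist v v'))"
        by (rule sol_bound) (use P[OF D(2,1)] Pb[OF D(1) F] in auto)
      then show "dist (\<Phi> v s) (\<Phi> v' s) \<le> 2 * N * \<mu> * L * dist v v'"
        using \<Phi> v by (simp add: dist_real_def mult_ac)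
    qed
  qed (use contr in auto)
  then obtain vb where vb: "vb \<in> S" "\<Phi> vb = vb" by blast
  define v where "v = apply_bcontfun vb"
  have v: "per1 v" "\<And>s. \<bar>v s\<bar> \<le> r" "continuous_on UNIV v" using vb by (auto simp: S_def v_def)
  have sv: "sol (P (F v)) v" using R[OF v(1,3)] \<Phi>[OF vb(1)] vb(2) by (simp add: v_def)
  let ?v' = "\<lambda>s. (P (F v) s - c * v s) / \<mu>"
  obtain w where w: "per1 w" "\<And>s. (w has_real_derivative v s) (at s)"
    using sol_w[OF sv P] Fper Fcont v by blast
  have hv: "continuous_on UNIV (\<lambda>s. h (v s))"
    using continuous_on_compose2[OF h(1) v(3)] by auto
  show ?thesis
  proof (rule that[of w v ?v' "- integral {0..1} (F v)"])
    show "continuous_on UNIV ?v'"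
      using mu by (intro continuous_intros P Fper Fcont v) auto
    show "- integral {0..1} (F v) - c * v s + \<mu> * (- ?v' s + h (v s)) = - g s" for s
      using mu by (simp add: P_def F_def field_simps)
    have "g integrable_on {0..1}" "(\<lambda>s. h (v s)) integrable_on {0..1}"
      using g(2) hv by (meson continuous_on_subset integrable_continuous_real subset_UNIV)+
    then have "integral {0..1} (F v) = integral {0..1} g + \<mu> * integral {0..1} (\<lambda>s. h (v s))"
      unfolding F_def by (subst integral_add) (simp_all add: integrable_on_mult_right)
    moreover have "\<bar>\<mu> * integral {0..1} (\<lambda>s. h (v s))\<bar> \<le> \<mu> * (L * r)"
      using mean_le[OF hv hb] v mu by (simp add: abs_mult)
    ultimately show "\<bar>- integral {0..1} (F v) + integral {0..1} g\<bar> \<le> \<mu> * L * r"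
      by (simp add: mult.assoc)
  qed (use w sv in \<open>auto simp: sol_def\<close>)
qed

section \<open>The maximum principle and waves on the torus\<close>

lemma line_DERIV:
  assumes "(f has_derivative (\<lambda>v. G \<bullet> v)) (at (x + h *\<^sub>R axis i 1))"
  shows "((\<lambda>h. f (x + h *\<^sub>R axis i 1)) has_real_derivative G $ i) (at h)"
proof -
  have "((\<lambda>h. f (x + h *\<^sub>R axis i 1)) has_derivative (\<lambda>h. G \<bullet> (h *\<^sub>R axis i 1))) (at h)"
    by (rule has_derivative_compose[where f = "\<lambda>h. x + h *\<^sub>R axis i 1" and g = f, THEN has_derivative_eq_rhs])
      (use assms in \<open>auto intro!: derivative_eq_intros\<close>)
  then show ?thesis
    by (simp add: has_field_derivative_def inner_axis mult.commute[of _ "G $ i"])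
qed

lemma pdiff_eq:
  assumes "(f has_derivative (\<lambda>v. G \<bullet> v)) (at x)"
  shows "pdiff i f x = G $ i"
  using line_DERIV[of f G x 0 i] assms by (simp add: pdiff_def DERIV_imp_deriv)

lemma component_derivative:
  assumes "(g has_derivative (\<lambda>v. A *v v)) (at x)"
  shows "((\<lambda>y. g y $ i) has_derivative (\<lambda>v. (A $ i) \<bullet> v)) (at x)"
  using bounded_linear.has_derivative[OF bounded_linear_vec_nth assms, of i]
  by (simp add: matrix_vector_mul_component)

lemma grad_eq:
  assumes "\<And>x. (f has_derivative (\<lambda>v. g x \<bullet> v)) (at x)"
  shows "grad f x = g x"
  by (simp add: grad_def pdiff_eq[OF assms] vec_eq_iff)

lemma lapl_eq:
  assumes "\<And>x. (f has_derivative (\<lambda>v. g x \<bullet> v)) (at x)"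
    and "\<And>x. (g has_derivative (\<lambda>v. A x *v v)) (at x)"
  shows "lapl f x = (\<Sum>i\<in>UNIV. A x $ i $ i)"
proof -
  have "pdiff i f = (\<lambda>x. g x $ i)" for i by (rule ext) (rule pdiff_eq[OF assms(1)])
  then show ?thesis by (simp add: lapl_def pdiff_eq[OF component_derivative[OF assms(2)]])
qed

text \<open>\<open>C12per\<close> does not state joint continuity of the function itself, which
  attaining a maximum over space-time requires. Total differentiability follows once the partial
  derivative in the second variable is jointly continuous; that derivative is \<open>ft\<close>, so
  time is moved to the second place.\<close>

lemma partial_derivs_imp_continuous:
  fixes f :: "real \<Rightarrow> 'a::real_normed_vector \<Rightarrow> real"
  assumes t: "\<And>t x. ((\<lambda>s. f s x) has_real_derivative ft t x) (at t)"
    and x: "\<And>t x. (f t has_derivative f' t x) (at x)"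
    and c: "continuous_on UNIV (\<lambda>(t,x). ft t x)"
  shows "continuous_on UNIV (\<lambda>(t,x). f t x)"
proof -
  have "continuous_on UNIV (\<lambda>z. f (snd z) (fst z))"
  proof -
    have ftc: "continuous_on UNIV (\<lambda>z. ft (snd z) (fst z))"
      using continuous_on_compose2[OF c, of UNIV "\<lambda>z::'a \<times> real. (snd z, fst z)"]
      by (simp add: continuous_on_Pair continuous_on_fst continuous_on_snd)
    have "((\<lambda>(x, t). f t x) has_derivative (\<lambda>(tx, ty). f' t x tx + blinfun_apply (blinfun_mult_right (ft t x)) ty))
        (at (x, t) within UNIV \<times> UNIV)" for x t
    proof (rule has_derivative_partialsI)
      show "continuous (at (x, t) within UNIV \<times> UNIV) (\<lambda>(x, t). blinfun_mult_right (ft t x))"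
        using bounded_linear.continuous_on[OF bounded_linear_blinfun_mult_right ftc]
        by (auto simp: continuous_on_eq_continuous_within case_prod_unfold)
    qed (use t x in \<open>auto simp: has_field_derivative_def\<close>)
    then show ?thesis
      unfolding continuous_on_eq_continuous_within case_prod_unfold
      by (auto dest: has_derivative_continuous)
  qed
  then show ?thesis
    using continuous_on_compose2[of UNIV "\<lambda>z. f (snd z) (fst z)" UNIV "\<lambda>z. (snd z, fst z)"]
    by (simp add: case_prod_unfold continuous_on_Pair continuous_on_fst continuous_on_snd)
qed

section \<open>Periodicity in all coordinates and attained maxima\<close>

lemma per_x_int_shift:
  fixes f :: "real^'d::finite \<Rightarrow> real"
  assumes "per_x f"
  shows "f (x + (\<Sum>i\<in>S. of_int (k i) *\<^sub>R axis i 1)) = f x"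
proof -
  have "finite S" by simp
  then show ?thesis
  proof (induction S rule: finite_induct)
    case (insert j S)
    let ?y = "x + (\<Sum>i\<in>S. of_int (k i) *\<^sub>R axis i 1)"
    have "per1 (\<lambda>h. f (?y + h *\<^sub>R axis j 1))"
      using assms by (simp add: per1_def per_x_def scaleR_add_left add.assoc[symmetric])
    from per1_of_int[OF this, of 0 "k j"] insert show ?case
      by (simp add: algebra_simps)
  qed simp
qed

lemma per_x_frac:
  fixes f :: "real^'d::finite \<Rightarrow> real"
  assumes "per_x f"
  shows "f (\<chi> i. frac (x $ i)) = f x"
proof -
  have "(\<chi> i. frac (x $ i)) + (\<Sum>i\<in>UNIV. of_int \<lfloor>x $ i\<rfloor> *\<^sub>R axis i 1) = x"
    by (simp add: vec_eq_iff frac_def axis_def if_distrib cong: if_cong)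
  then show ?thesis using per_x_int_shift[OF assms, of "\<chi> i. frac (x $ i)" "\<lambda>i. \<lfloor>x $ i\<rfloor>" UNIV] by simp
qed

text \<open>Fractional parts of \<open>t / T\<close> and of the coordinates fold every point into a
  compact cell without changing \<open>d\<close>.\<close>

lemma space_time_periodic_attains_max:
  fixes d :: "real \<Rightarrow> real^'d::finite \<Rightarrow> real"
  assumes "T > 0" and "continuous_on UNIV (\<lambda>(t,x). d t x)"
    and t: "\<And>t x. d (t + T) x = d t x" and x: "\<And>t. per_x (d t)"
  obtains t0 x0 where "\<And>t x. d t x \<le> d t0 x0"
proof -
  have "compact ({0..T} \<times> cbox (0::real^'d) One)" by (intro compact_Times) auto
  moreover have "(0, 0) \<in> {0..T} \<times> cbox (0::real^'d) One"
    using \<open>T > 0\<close> by (auto simp: mem_box)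
  ultimately obtain z where z: "\<forall>y\<in>{0..T} \<times> cbox (0::real^'d) One. (\<lambda>(t,x). d t x) y \<le> (\<lambda>(t,x). d t x) z"
    using continuous_attains_sup[OF _ _ continuous_on_subset[OF assms(2)]] by blast
  have "d t x \<le> d (fst z) (snd z)" for t x
  proof -
    let ?t = "T * frac (t / T)" and ?x = "\<chi> i. frac (x $ i)"
    have "per1 (\<lambda>s. d (T * s) x)" using t by (simp add: per1_def distrib_left)
    from per1_frac[OF this, of "t / T"] have "d ?t x = d t x" using \<open>T > 0\<close> by simp
    then have "d ?t ?x = d t x" using per_x_frac[OF x, of ?t x] by simp
    moreover have "?t \<in> {0..T}"
      using \<open>T > 0\<close> frac_lt_1[of "t / T"] by (simp add: mult_le_cancel_left1 less_imp_le)
    moreover have "?x \<in> cbox 0 One"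
      unfolding mem_box
    proof
      fix b :: "real^'d" assume b: "b \<in> Basis"
      then obtain k where "b = axis k 1" by (auto simp: Basis_vec_def)
      then show "0 \<bullet> b \<le> ?x \<bullet> b \<and> ?x \<bullet> b \<le> One \<bullet> b"
        using inner_sum_left_Basis[OF b, of "\<lambda>_. 1"] frac_lt_1[of "x $ k"]
        by (simp add: inner_axis less_imp_le)
    qed
    ultimately show ?thesis using z[rule_format, of "(?t, ?x)"] by (simp add: case_prod_unfold)
  qed
  then show ?thesis using that by blast
qed

text \<open>At the maximum \<open>f'\<close> vanishes; if \<open>l\<close> were positive,
  \<open>f'\<close> would be positive just to the right, and the mean value theorem would give a
  larger value of \<open>f\<close>.\<close>

lemma second_derivative_nonpos_at_max:
  fixes f f' :: "real \<Rightarrow> real"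
  assumes d: "\<And>h. (f has_real_derivative f' h) (at h)" and d2: "(f' has_real_derivative l) (at x)"
    and max: "\<And>h. f h \<le> f x"
  shows "l \<le> 0"
proof (rule ccontr)
  assume "\<not> l \<le> 0"
  then obtain e where e: "e > 0" "\<And>h. 0 < h \<Longrightarrow> h < e \<Longrightarrow> f' x < f' (x + h)"
    using DERIV_pos_inc_right[OF d2] by force
  have x0: "f' x = 0" using DERIV_local_max[OF d, of 1] max by auto
  obtain z where z: "x < z" "z < x + e / 2" "f (x + e / 2) - f x = (x + e / 2 - x) * f' z"
    using MVT2[of x "x + e / 2" f f'] d e by auto
  have "f' z > 0" using e(2)[of "z - x"] z(1,2) e(1) x0 by auto
  then have "(x + e / 2 - x) * f' z > 0" using e(1) by (intro mult_pos_pos) auto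
  then show False using max[of "x + e / 2"] z(3) by linarith
qed

text \<open>Maximum principle: compare the two equations at a maximum of the difference of the
  eigenfunctions.\<close>

lemma is_eigenvalue_le:
  fixes H :: "real^'d::finite \<Rightarrow> real"
  assumes "T > 0" "\<mu> > 0" and 1: "is_eigenvalue T H m \<mu> l1" and 2: "is_eigenvalue T H m \<mu> l2"
  shows "l1 \<le> l2"
proof -
  obtain f where f: "C12per T f"
    "\<And>t x. l1 + dt f t x + \<mu> * (- lapl (f t) x + H (grad (f t) x)) = - m t x"
    using 1 unfolding is_eigenvalue_def by blast
  obtain g where g: "C12per T g"
    "\<And>t x. l2 + dt g t x + \<mu> * (- lapl (g t) x + H (grad (g t) x)) = - m t x"
    using 2 unfolding is_eigenvalue_def by blast
  obtain ft Gf Af where F: "\<And>t x. ((\<lambda>s. f s x) has_real_derivative ft t x) (at t)"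
      "\<And>t x. (f t has_derivative (\<lambda>v. Gf t x \<bullet> v)) (at x)"
      "\<And>t x. (Gf t has_derivative (\<lambda>v. Af t x *v v)) (at x)"
      "continuous_on UNIV (\<lambda>(t,x). ft t x)"
    using f(1) unfolding C12per_def by blast
  obtain gt Gg Ag where G: "\<And>t x. ((\<lambda>s. g s x) has_real_derivative gt t x) (at t)"
      "\<And>t x. (g t has_derivative (\<lambda>v. Gg t x \<bullet> v)) (at x)"
      "\<And>t x. (Gg t has_derivative (\<lambda>v. Ag t x *v v)) (at x)"
      "continuous_on UNIV (\<lambda>(t,x). gt t x)"
    using g(1) unfolding C12per_def by blast
  define d where "d t x = f t x - g t x" for t x
  have "continuous_on UNIV (\<lambda>(t,x). d t x)"
    using partial_derivs_imp_continuous[OF F(1,2,4)] partial_derivs_imp_continuous[OF G(1,2,4)]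
    unfolding d_def case_prod_unfold by (rule continuous_on_diff)
  moreover have "d (t + T) x = d t x" "per_x (d t)" for t x
    using f(1) g(1) by (auto simp: C12per_def per_x_def d_def)
  ultimately obtain t x where max: "\<And>s y. d s y \<le> d t x"
    using space_time_periodic_attains_max \<open>T > 0\<close> by metis
  have "((\<lambda>s. d s x) has_real_derivative (ft t x - gt t x)) (at t)"
    unfolding d_def by (intro DERIV_diff F G)
  from DERIV_local_max[OF this, of 1] have t_eq: "ft t x = gt t x" using max by simp
  have line: "((\<lambda>h. d t (x + h *\<^sub>R axis i 1)) has_real_derivative
      (Gf t (x + h *\<^sub>R axis i 1) $ i - Gg t (x + h *\<^sub>R axis i 1) $ i)) (at h)" for i h
    unfolding d_def by (intro DERIV_diff line_DERIV F G)
  have line2: "((\<lambda>h. Gf t (x + h *\<^sub>R axis i 1) $ i - Gg t (x + h *\<^sub>R axis i 1) $ i) has_real_derivative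
      (Af t (x + h *\<^sub>R axis i 1) $ i $ i - Ag t (x + h *\<^sub>R axis i 1) $ i $ i)) (at h)" for i h
    by (intro DERIV_diff line_DERIV component_derivative F G)
  have "Gf t x $ i = Gg t x $ i" for i
    using DERIV_local_max[OF line[where i = i and h = 0], of 1] max by auto
  then have G_eq: "Gf t x = Gg t x" by (simp add: vec_eq_iff)
  have "Af t x $ i $ i - Ag t x $ i $ i \<le> 0" for i
    using second_derivative_nonpos_at_max[OF line line2[where i = i and h = 0]] max by simp
  then have "(\<Sum>i\<in>UNIV. Af t x $ i $ i) \<le> (\<Sum>i\<in>UNIV. Ag t x $ i $ i)"
    by (intro sum_mono) simp
  then have "lapl (f t) x \<le> lapl (g t) x"
    by (simp add: lapl_eq[OF F(2,3)] lapl_eq[OF G(2,3)])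
  then have "\<mu> * lapl (f t) x \<le> \<mu> * lapl (g t) x" using \<open>\<mu> > 0\<close> by simp
  moreover have "dt f t x = dt g t x" "grad (f t) x = grad (g t) x"
    using t_eq G_eq DERIV_imp_deriv[OF F(1)] DERIV_imp_deriv[OF G(1)]
    by (simp_all add: dt_def grad_eq[OF F(2)] grad_eq[OF G(2)])
  \<comment> \<open>The time derivatives and the \<open>H\<close> terms cancel at the maximum,
    leaving l1 - l2 = \<mu> (lapl f - lapl g) \<le> 0.\<close>
  ultimately show ?thesis using f(2)[of t x] g(2)[of t x] by (simp add: algebra_simps)
qed

text \<open>The comparison used in both directions gives uniqueness, so any one eigenfunction
  resolves the definite description.\<close>

lemma eigenvalue_H_eqI:
  assumes "T > 0" "\<mu> > 0" "is_eigenvalue T H m \<mu> lam"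
  shows "eigenvalue_H T H m \<mu> = lam"
  unfolding eigenvalue_H_def
  using assms by (intro the_equality antisym is_eigenvalue_le[where m = m and H = H]) auto

section \<open>Plane waves of speed \<open>1 / T\<close> along coordinate \<open>i\<close>\<close>

context
  fixes T :: real and i :: "'d::finite" and w w' w'' :: "real \<Rightarrow> real"
  assumes T: "T > 0" and per: "per1 w"
    and w: "\<And>s. (w has_real_derivative w' s) (at s)"
    and w': "\<And>s. (w' has_real_derivative w'' s) (at s)"
    and w'': "continuous_on UNIV w''"
begin

abbreviation (input) phase :: "real \<Rightarrow> real^'d \<Rightarrow> real" where "phase t x \<equiv> x $ i - t / T"

lemma wave_deriv_t: "((\<lambda>s. w (phase s x)) has_real_derivative (- w' (phase t x) / T)) (at t)"
proof -
  have "((\<lambda>s. phase s x) has_real_derivative - 1 / T) (at t)"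
    using T by (auto intro!: derivative_eq_intros)
  from DERIV_chain2[OF w this] show ?thesis by simp
qed

lemma wave_deriv_x:
  assumes u: "\<And>s. (u has_real_derivative u' s) (at s)"
  shows "((\<lambda>x. u (phase t x)) has_derivative (\<lambda>v. u' (phase t x) * v $ i)) (at x)"
proof -
  have "((\<lambda>x. phase t x) has_derivative (\<lambda>v. v $ i - 0)) (at x)"
    by (intro has_derivative_diff bounded_linear_imp_has_derivative bounded_linear_vec_nth has_derivative_const)
  then have "((\<lambda>x. phase t x) has_derivative (\<lambda>v. v $ i)) (at x)" by simp
  from has_derivative_compose[OF this u[unfolded has_field_derivative_def]] show ?thesis .
qed

lemma wave_grad_deriv: "((\<lambda>x. w (phase t x)) has_derivative (\<lambda>v. (w' (phase t x) *\<^sub>R axis i 1) \<bullet> v)) (at x)"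
  using wave_deriv_x[OF w] by (simp add: inner_axis inner_commute[of "axis _ _"])

text \<open>The rank-one matrix e_i e_i^T, of trace 1; the Hessian of a plane wave is a multiple of
  it.\<close>

definition unit_matrix :: "real^'d^'d" where "unit_matrix = (\<chi> j k. if j = i \<and> k = i then 1 else 0)"

lemma wave_hess_deriv:
  "((\<lambda>x. w' (phase t x) *\<^sub>R axis i 1) has_derivative (\<lambda>v. (w'' (phase t x) *\<^sub>R unit_matrix) *v v)) (at x)"
proof -
  have "unit_matrix *v v = v $ i *\<^sub>R axis i 1" for v
    by (simp add: unit_matrix_def vec_eq_iff matrix_vector_mult_def axis_def if_distrib if_distribR cong: if_cong)
  moreover have "((\<lambda>x. w' (phase t x) *\<^sub>R axis i 1) has_derivative
      (\<lambda>v. (w'' (phase t x) * v $ i) *\<^sub>R axis i 1)) (at x)"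
    by (intro has_derivative_scaleR_left wave_deriv_x[OF w'])
  ultimately show ?thesis by (simp add: scaleR_matrix_vector_assoc[symmetric])
qed

lemma wave_C12per: "C12per T (\<lambda>t x. w (phase t x))"
proof -
  have ph: "continuous_on UNIV (\<lambda>(t, x). u (phase t x))" if "continuous_on UNIV u" for u :: "real \<Rightarrow> real"
    unfolding case_prod_unfold
    by (rule continuous_on_compose2[OF that]) (use T in \<open>auto intro!: continuous_intros\<close>)
  have "continuous_on UNIV w'" using w' by (rule DERIV_imp_continuous_on)
  note c = ph[OF this] ph[OF w'']
  have sh: "w (s + 1) = w s" "w (s - 1) = w s" for s
    using per unfolding per1_def by (auto, metis diff_add_cancel)
  show ?thesis unfolding C12per_def
  proof (intro conjI allI exI)
    \<comment> \<open>The speed \<open>1 / T\<close> is chosen so that the phase moves by exactly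
      one period of \<open>w\<close> during time \<open>T\<close>.\<close>
    show "w (phase (t + T) x) = w (phase t x)" for t x
      using sh(2)[of "phase t x"] T by (simp add: add_divide_distrib algebra_simps)
    show "per_x (\<lambda>x. w (phase t x))" for t
    proof -
      have "w (phase t (x + axis j 1)) = w (phase t x)" for x j
        using sh(1)[of "phase t x"] by (cases "j = i") (simp_all add: axis_def algebra_simps)
      then show ?thesis by (simp add: per_x_def)
    qed
    show "continuous_on UNIV (\<lambda>(t, x). - w' (phase t x) / T)"
      using c(1) T unfolding case_prod_unfold by (auto intro!: continuous_intros)
    show "continuous_on UNIV (\<lambda>(t, x). w' (phase t x) *\<^sub>R axis i (1::real))"
      using c(1) unfolding case_prod_unfold by (auto intro!: continuous_intros)
    show "continuous_on UNIV (\<lambda>(t, x). w'' (phase t x) *\<^sub>R unit_matrix)"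
      using c(2) unfolding case_prod_unfold by (auto intro!: continuous_intros)
  qed (rule wave_deriv_t wave_grad_deriv wave_hess_deriv)+
qed

lemma wave_is_eigenvalue:
  assumes "\<And>s. lam - w' s / T + \<mu> * (- w'' s + H (w' s *\<^sub>R axis i 1)) = - g s"
  shows "is_eigenvalue T H (\<lambda>t x. g (phase t x)) \<mu> lam"
proof -
  have "(\<Sum>j\<in>UNIV. (y *\<^sub>R unit_matrix) $ j $ j) = y" for y
    by (simp add: unit_matrix_def if_distrib cong: if_cong)
  moreover have "dt (\<lambda>t x. w (phase t x)) t x = - w' (phase t x) / T" for t x
    unfolding dt_def by (rule DERIV_imp_deriv) (rule wave_deriv_t)
  ultimately have "lam + dt (\<lambda>t x. w (phase t x)) t x + \<mu> * (- lapl (\<lambda>x. w (phase t x)) x +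
      H (grad (\<lambda>x. w (phase t x)) x)) = - g (phase t x)" for t x
    using assms[of "phase t x"]
    by (simp add: lapl_eq[OF wave_grad_deriv wave_hess_deriv] grad_eq[OF wave_grad_deriv])
  then show ?thesis unfolding is_eigenvalue_def using wave_C12per by blast
qed

end

section \<open>Small, intermediate and large viscosity\<close>

text \<open>That \<open>v\<close> has mean zero is encoded by its periodic antiderivative
  \<open>w\<close>, which is the wave profile itself.\<close>

definition wave_solvable :: "real \<Rightarrow> (real \<Rightarrow> real) \<Rightarrow> (real \<Rightarrow> real) \<Rightarrow> real \<Rightarrow> real \<Rightarrow> bool" where
  "wave_solvable c h g \<mu> lam \<longleftrightarrow> (\<exists>w v v'. per1 w \<and> (\<forall>s. (w has_real_derivative v s) (at s)) \<and>
     (\<forall>s. (v has_real_derivative v' s) (at s)) \<and> continuous_on UNIV v' \<and>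
     (\<forall>s. lam - c * v s + \<mu> * (- v' s + h (v s)) = - g s))"

lemma DERIV_bound_imp_lipschitz:
  fixes h h' :: "real \<Rightarrow> real"
  assumes "\<And>q. (h has_real_derivative h' q) (at q)" "\<And>q. \<bar>q\<bar> \<le> r \<Longrightarrow> \<bar>h' q\<bar> \<le> L"
    and "\<bar>q\<bar> \<le> r" "\<bar>q'\<bar> \<le> r"
  shows "\<bar>h q - h q'\<bar> \<le> L * \<bar>q - q'\<bar>"
proof -
  have "norm (h q - h q') \<le> L * norm (q - q')"
    by (rule field_differentiable_bound[of "{-r..r}" h h'])
      (use assms in \<open>auto simp: abs_le_iff intro: has_field_derivative_at_within\<close>)
  then show ?thesis by simp
qed

text \<open>The choice \<open>N = 1 / c\<close> does not involve \<mu>, so the radius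
  \<open>r\<close> and the Lipschitz constant \<open>L\<close> on [-r, r] are fixed before \<mu> is
  taken small.\<close>

lemma wave_solvable_small:
  fixes g h h' :: "real \<Rightarrow> real"
  assumes c: "c > 0" and g: "per1 g" "continuous_on UNIV g" and K: "integral {0..1} g < 0"
    and h: "\<And>q. (h has_real_derivative h' q) (at q)" "continuous_on UNIV h'" "h 0 = 0"
  obtains \<mu> lam where "0 < \<mu>" "\<mu> < 1" "lam > 0" "wave_solvable c h g \<mu> lam"
proof -
  define K where "K = - integral {0..1} g"
  have "K > 0" using K by (simp add: K_def)
  obtain G where G: "G > 0" "\<And>s. \<bar>g s\<bar> \<le> G" using per1_bounded[OF g] by blast
  \<comment> \<open>With this radius the ball is mapped into itself as soon as \<mu> L \<le> c / 4,
    since then \<mu> L r \<le> G.\<close>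
  define r where "r = 4 * G / c"
  have r: "r > 0" using G c by (simp add: r_def)
  have "bounded (h' ` {-r..r})"
    by (intro compact_imp_bounded compact_continuous_image continuous_on_subset[OF h(2)]) auto
  then obtain L where L: "L > 0" "\<And>q. \<bar>q\<bar> \<le> r \<Longrightarrow> \<bar>h' q\<bar> \<le> L"
    unfolding bounded_pos by (force simp: abs_le_iff)
  \<comment> \<open>In order: \<mu> < 1; contraction constant at most 1/2 and the self-map
    condition; \<mu> L r \<le> K / 2, which keeps \<open>lam\<close> at least K / 2.\<close>
  define \<mu> where "\<mu> = min (1 / 2) (min (c / (4 * L)) (K / (2 * L * r)))"
  have mu: "0 < \<mu>" "\<mu> < 1" "\<mu> \<le> c / (4 * L)" "\<mu> \<le> K / (2 * L * r)"
    using L r c \<open>K > 0\<close> by (auto simp: \<mu>_def)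
  have mL: "4 * (\<mu> * L) \<le> c" using mu(3) L by (simp add: field_simps)
  have mLr: "2 * (\<mu> * L * r) \<le> K" using mu(4) L r by (simp add: field_simps)
  obtain w v v' lam where sol: "per1 w" "\<And>s. (w has_real_derivative v s) (at s)"
    "\<And>s. (v has_real_derivative v' s) (at s)" "continuous_on UNIV v'"
    "\<And>s. lam - c * v s + \<mu> * (- v' s + h (v s)) = - g s"
    "\<bar>lam + integral {0..1} g\<bar> \<le> \<mu> * L * r"
  proof (rule travelling_wave_exists[OF c mu(1) g G(2) DERIV_imp_continuous_on[OF h(1)] h(3)
        DERIV_bound_imp_lipschitz[OF h(1) L(2)]])
    show "2 * (1 / c) * \<mu> * L < 1" using mL c by (simp add: field_simps)
    have "4 * (\<mu> * L) * r \<le> c * r" using mL r by (intro mult_right_mono) auto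
    moreover have "c * r = 4 * G" using c by (simp add: r_def)
    ultimately have "2 * (G + \<mu> * L * r) \<le> c * r" by (simp add: mult.assoc)
    then show "2 * (1 / c) * (G + \<mu> * L * r) \<le> r" using c by (simp add: field_simps)
  qed (use L r in auto)
  show ?thesis
  proof (rule that[OF mu(1,2)])
    show "lam > 0" using sol(6) mLr \<open>K > 0\<close> by (simp add: K_def)
    show "wave_solvable c h g \<mu> lam" unfolding wave_solvable_def using sol by blast
  qed
qed

text \<open>With \<open>N = 2 / \<mu>\<close> the factor \<mu> cancels and the contraction constant
  is 4 L. The radius shrinks like 1 / \<mu>, and \<open>h' 0 = 0\<close> makes \<open>L\<close>
  small near 0.\<close>

lemma wave_solvable_large:
  fixes g h h' :: "real \<Rightarrow> real"
  assumes c: "c > 0" and g: "per1 g" "continuous_on UNIV g" and K: "integral {0..1} g < 0"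
    and h: "\<And>q. (h has_real_derivative h' q) (at q)" "continuous_on UNIV h'" "h 0 = 0" "h' 0 = 0"
  obtains \<mu> lam where "\<mu> > 1" "lam > 0" "wave_solvable c h g \<mu> lam"
proof -
  define K where "K = - integral {0..1} g"
  have "K > 0" using K by (simp add: K_def)
  obtain G where G: "G > 0" "\<And>s. \<bar>g s\<bar> \<le> G" using per1_bounded[OF g] by blast
  \<comment> \<open>The value 1/8 gives 4 L \<le> 1/2 and 8 L G \<le> G; the other bound gives \<mu>
    L r = 8 L G \<le> K / 2.\<close>
  define L where "L = min (1 / 8) (K / (16 * G))"
  have L: "L > 0" "L \<le> 1 / 8" "L \<le> K / (16 * G)" using G \<open>K > 0\<close> by (auto simp: L_def)
  have "isCont h' 0" using h(2) by (simp add: continuous_on_eq_continuous_at)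
  then obtain \<delta>' where d': "\<delta>' > 0" "\<And>q. \<bar>q\<bar> < \<delta>' \<Longrightarrow> \<bar>h' q\<bar> < L"
    using L(1) h(4) unfolding continuous_at_eps_delta by (force simp: dist_real_def)
  define \<delta> where "\<delta> = \<delta>' / 2"
  have d: "\<delta> > 0" "\<And>q. \<bar>q\<bar> \<le> \<delta> \<Longrightarrow> \<bar>h' q\<bar> \<le> L" using d' by (auto simp: \<delta>_def intro!: less_imp_le)
  \<comment> \<open>The 2 ensures \<mu> > 1; the other term places the radius r = 8 G / \<mu> within
    \<delta>, where |h'| \<le> L. This \<open>r\<close> satisfies (4 / \<mu>) (G + 8 L G) \<le>
    r.\<close>
  define \<mu> where "\<mu> = max 2 (8 * G / \<delta>)"
  have mu: "\<mu> > 1" "\<mu> > 0" "8 * G / \<delta> \<le> \<mu>" by (auto simp: \<mu>_def)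
  define r where "r = 8 * G / \<mu>"
  have r: "r > 0" "r \<le> \<delta>" "\<mu> * r = 8 * G" using mu G d by (auto simp: r_def field_simps)
  have "16 * (L * G) \<le> K" using L(3) G by (simp add: field_simps)
  moreover have "\<mu> * L * r = L * (\<mu> * r)" by simp
  then have LG: "\<mu> * L * r = 8 * (L * G)" unfolding r(3) by simp
  ultimately have mLr: "2 * (\<mu> * L * r) \<le> K" by linarith
  obtain w v v' lam where sol: "per1 w" "\<And>s. (w has_real_derivative v s) (at s)"
    "\<And>s. (v has_real_derivative v' s) (at s)" "continuous_on UNIV v'"
    "\<And>s. lam - c * v s + \<mu> * (- v' s + h (v s)) = - g s"
    "\<bar>lam + integral {0..1} g\<bar> \<le> \<mu> * L * r"
  proof (rule travelling_wave_exists[OF c mu(2) g G(2) DERIV_imp_continuous_on[OF h(1)] h(3)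
        DERIV_bound_imp_lipschitz[OF h(1), of r L]])
    show "\<bar>h' q\<bar> \<le> L" if "\<bar>q\<bar> \<le> r" for q using d(2) that r(2) by simp
    show "2 * (2 / \<mu>) * \<mu> * L < 1" using mu L by simp
    have "L * G \<le> 1 / 8 * G" using L G by (intro mult_right_mono) auto
    then have "4 * (G + \<mu> * L * r) \<le> \<mu> * r" unfolding LG r(3) by (simp add: mult_ac)
    then show "2 * (2 / \<mu>) * (G + \<mu> * L * r) \<le> r" using mu by (simp add: field_simps)
  qed (use L r in auto)
  show ?thesis
  proof (rule that[OF mu(1)])
    show "lam > 0" using sol(6) mLr \<open>K > 0\<close> by (simp add: K_def)
    show "wave_solvable c h g \<mu> lam" unfolding wave_solvable_def using sol by blast
  qed
qed

lemma C2_line: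
  fixes H :: "real^'d::finite \<Rightarrow> real"
  assumes "C2 H"
  obtains h' h'' where "\<And>q. ((\<lambda>q. H (q *\<^sub>R axis i 1)) has_real_derivative h' q) (at q)"
    "\<And>q. (h' has_real_derivative h'' q) (at q)" "continuous_on UNIV h''"
proof -
  obtain g A where H: "\<And>x. (H has_derivative (\<lambda>v. g x \<bullet> v)) (at x)"
    "\<And>x. (g has_derivative (\<lambda>v. A x *v v)) (at x)"
    "continuous_on UNIV (A :: real^'d \<Rightarrow> real^'d^'d)"
    using assms unfolding C2_def by blast
  show ?thesis
  proof (rule that)
    show "((\<lambda>q. H (q *\<^sub>R axis i 1)) has_real_derivative g (q *\<^sub>R axis i 1) $ i) (at q)" for q
      using line_DERIV[OF H(1), where x = 0] by simp
    show "((\<lambda>q. g (q *\<^sub>R axis i 1) $ i) has_real_derivative A (q *\<^sub>R axis i 1) $ i $ i) (at q)" for q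
    proof -
      have "((\<lambda>h. g (0 + h *\<^sub>R axis i 1) $ i) has_real_derivative A (0 + q *\<^sub>R axis i 1) $ i $ i) (at q)"
        by (intro line_DERIV component_derivative H)
      then show ?thesis by simp
    qed
    have "continuous_on UNIV (\<lambda>q. A (q *\<^sub>R axis i 1))"
      by (rule continuous_on_compose2[OF H(3)]) (auto intro!: continuous_intros)
    then show "continuous_on UNIV (\<lambda>q. A (q *\<^sub>R axis i 1) $ i $ i)"
      by (intro continuous_intros)
  qed
qed

lemma wave_solvable_imp_eigenvalue:
  fixes H :: "real^'d::finite \<Rightarrow> real"
  assumes "T > 0" "\<mu> > 0" "wave_solvable (1 / T) (\<lambda>q. H (q *\<^sub>R axis i 1)) g \<mu> lam"
  shows "eigenvalue_H T H (\<lambda>t x. g (x $ i - t / T)) \<mu> = lam"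
proof -
  obtain w v v' where w: "per1 w" "\<And>s. (w has_real_derivative v s) (at s)"
     "\<And>s. (v has_real_derivative v' s) (at s)" "continuous_on UNIV v'"
     "\<And>s. lam - v s / T + \<mu> * (- v' s + H (v s *\<^sub>R axis i 1)) = - g s"
    using assms(3) unfolding wave_solvable_def by auto
  show ?thesis
    by (intro eigenvalue_H_eqI assms wave_is_eigenvalue[OF \<open>T > 0\<close> w(1,2,3,4)] w(5))
qed

theorem theorem1p9:
  fixes H :: "real^'d::finite \<Rightarrow> real" and T :: real
  assumes "T > 0" and "assumption_H H"
  shows "\<exists>m. C12per T m \<and>
    \<not> ((\<forall>a b. 0 < a \<and> a \<le> b \<longrightarrow> eigenvalue_H T H m a \<le> eigenvalue_H T H m b) \<or>
       (\<forall>a b. 0 < a \<and> a \<le> b \<longrightarrow> eigenvalue_H T H m a \<ge> eigenvalue_H T H m b))"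
proof -
  fix i :: 'd
  define h where "h = (\<lambda>q. H (q *\<^sub>R axis i 1))"
  have H: "C2 H" "H 0 = 0" "\<And>p. p \<noteq> 0 \<Longrightarrow> H p > 0"
    using assms(2)[unfolded assumption_H_def, THEN conjunct1]
      assms(2)[unfolded assumption_H_def, THEN conjunct2, THEN conjunct1]
      assms(2)[unfolded assumption_H_def, THEN conjunct2, THEN conjunct2, THEN conjunct1] by blast+
  obtain h' h'' where h: "\<And>q. (h has_real_derivative h' q) (at q)"
    "\<And>q. (h' has_real_derivative h'' q) (at q)" "continuous_on UNIV h''"
    using C2_line[OF H(1), of i, folded h_def] by metis
  have h_0: "h 0 = 0" using H(2) by (simp add: h_def)
  have h_pos: "h q > 0" if "q \<noteq> 0" for q
    using H(3)[of "q *\<^sub>R axis i 1"] that by (simp add: h_def axis_eq_0_iff)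
  have hc: "continuous_on UNIV h" "continuous_on UNIV h'"
    using DERIV_imp_continuous_on[OF h(1)] DERIV_imp_continuous_on[OF h(2)] by blast+
  have hnn: "h q \<ge> 0" for q using h_0 h_pos[of q] by (cases "q = 0") auto
  \<comment> \<open>\<open>0\<close> is a global minimum of \<open>h\<close>; the vanishing slope is
    what the large-\<mu> case requires.\<close>
  have "h' 0 = 0" using DERIV_local_min[OF h(1)[of 0], of 1] hnn h_0 by simp
  define c where "c = 1 / T"
  have "c > 0" using assms(1) by (simp add: c_def)
  define S C where "S s = sin (2 * pi * s)" and "C s = cos (2 * pi * s)" for s :: real
  have SC: "(S has_real_derivative 2 * pi * C s) (at s)" "(C has_real_derivative - (2 * pi * S s)) (at s)" for s
    unfolding S_def C_def by (auto intro!: derivative_eq_intros)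
  have per: "S (s + 1) = S s" "C (s + 1) = C s" for s
    using sin_periodic[of "2 * pi * s"] cos_periodic[of "2 * pi * s"]
    by (simp_all add: S_def C_def distrib_left)
  have cont: "continuous_on A S" "continuous_on A C" for A
    using DERIV_imp_continuous_on[OF SC(1)] DERIV_imp_continuous_on[OF SC(2)] by blast+
  have chS: "continuous_on A (\<lambda>s. k (S s))" if "continuous_on UNIV k" for k :: "real \<Rightarrow> real" and A
    by (rule continuous_on_compose2[OF that cont(1)]) auto
  \<comment> \<open>Solved from the wave equation with \<mu> = 1, eigenvalue 0 and v =
    \<open>S\<close>, so that v' = \<open>2 * pi * C\<close>.\<close>
  define g where "g s = c * S s + 2 * pi * C s - h (S s)" for s
  \<comment> \<open>The potential \<open>m\<close> is itself a plane wave with profile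
    \<open>g\<close>, so \<open>wave_C12per\<close> applies to it once \<open>g\<close> has a
    continuous second derivative; this is where \<open>h''\<close> enters.\<close>
  define g' where "g' s = 2 * pi * c * C s - 4 * pi\<^sup>2 * S s - h' (S s) * (2 * pi * C s)" for s
  define g'' where "g'' s = - 4 * pi\<^sup>2 * c * S s - 8 * pi ^ 3 * C s
      - (h'' (S s) * (2 * pi * C s) * (2 * pi * C s) - h' (S s) * (4 * pi\<^sup>2 * S s))" for s
  have g_d: "(g has_real_derivative g' s) (at s)" for s
    unfolding g_def g'_def
    by (rule derivative_eq_intros SC DERIV_chain2[OF h(1)] refl)+
      (simp add: power2_eq_square algebra_simps)
  have g'_d: "(g' has_real_derivative g'' s) (at s)" for s
    unfolding g'_def g''_def
    by (rule derivative_eq_intros SC DERIV_chain2[OF h(2)] refl)+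
      (simp add: power2_eq_square power3_eq_cube algebra_simps)
  have g''_c: "continuous_on UNIV g''"
    unfolding g''_def by (intro continuous_intros cont chS h hc)
  have g: "per1 g" "continuous_on UNIV g"
    using DERIV_imp_continuous_on[OF g_d] by (auto simp: per1_def g_def per)
  have W: "((\<lambda>s. - C s / (2 * pi)) has_real_derivative S s) (at s)" for s
    using DERIV_cdivide[OF DERIV_minus[OF SC(2)[of s]], of "2 * pi"] by simp
  have wave1: "wave_solvable c h g 1 0"
  proof -
    have "((\<lambda>s. 2 * pi * C s) has_real_derivative - (4 * pi\<^sup>2 * S s)) (at s)" for s
      by (rule derivative_eq_intros SC refl)+ (simp add: power2_eq_square)
    with W show ?thesis
      unfolding wave_solvable_def
      by (intro exI[of _ "\<lambda>s. - C s / (2 * pi)"] exI[of _ S] exI[of _ "\<lambda>s. 2 * pi * C s"])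
        (auto simp: per1_def per g_def SC intro!: continuous_intros cont)
  qed
  have g_neg: "integral {0..1} g < 0"
  proof -
    \<comment> \<open>A periodic antiderivative of the trigonometric part of \<open>g\<close>, which
      therefore integrates to zero and leaves minus the integral of h(S).\<close>
    define F where "F s = c * (- C s / (2 * pi)) + S s" for s
    have Fd: "(F has_real_derivative (c * S s + 2 * pi * C s)) (at s)" for s
      unfolding F_def by (intro DERIV_add DERIV_cmult W SC)
    have "((\<lambda>s. c * S s + 2 * pi * C s) has_integral (F 1 - F 0)) {0..1}"
      using Fd by (intro fundamental_theorem_of_calculus)
        (auto simp: has_real_derivative_iff_has_vector_derivative[symmetric] intro: has_field_derivative_at_within)
    moreover have "F 1 = F 0" using per[of 0] by (simp add: F_def)
    moreover have hS: "(\<lambda>s. h (S s)) integrable_on {0..1}"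
      by (intro integrable_continuous_real chS hc)
    ultimately have "integral {0..1} g = - integral {0..1} (\<lambda>s. h (S s))"
      unfolding g_def by (subst integral_diff) (auto simp: integral_unique has_integral_integrable)
    \<comment> \<open>A continuous non-negative function with zero integral vanishes, but
      \<open>S (1 / 4) = 1\<close> and \<open>h 1 > 0\<close>.\<close>
    moreover have "integral {0..1} (\<lambda>s. h (S s)) \<noteq> 0"
    proof
      assume "integral {0..1} (\<lambda>s. h (S s)) = 0"
      then have "\<forall>s\<in>{0..1}. h (S s) = 0"
        using integral_eq_0_iff[of 0 1 "\<lambda>s. h (S s)"] chS[OF hc(1)] hnn by auto
      then have "h (S (1 / 4)) = 0" by auto
      then show False using h_pos[of 1] by (simp add: S_def)
    qed
    moreover have "integral {0..1} (\<lambda>s. h (S s)) \<ge> 0"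
      using hS hnn by (intro integral_nonneg) auto
    ultimately show ?thesis by simp
  qed
  obtain a la where a: "0 < a" "a < 1" "la > 0" "wave_solvable c h g a la"
    using wave_solvable_small[OF \<open>c > 0\<close> g g_neg h(1) hc(2)] h_0 by auto
  obtain b lb where b: "b > 1" "lb > 0" "wave_solvable c h g b lb"
    using wave_solvable_large[OF \<open>c > 0\<close> g g_neg h(1) hc(2)] h_0 \<open>h' 0 = 0\<close> by auto
  define m where "m t x = g (x $ i - t / T)" for t and x :: "real^'d"
  have ev: "eigenvalue_H T H m \<mu> = lam" if "\<mu> > 0" "wave_solvable c h g \<mu> lam" for \<mu> lam
    using wave_solvable_imp_eigenvalue[OF assms(1) that(1)] that(2) unfolding c_def h_def m_def by blast
  have "eigenvalue_H T H m a = la" "eigenvalue_H T H m 1 = 0" "eigenvalue_H T H m b = lb"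
    using ev a b wave1 by auto
  \<comment> \<open>The eigenvalue drops from \<open>la > 0\<close> to 0 between \<open>a\<close>
    and 1 and rises to \<open>lb > 0\<close> between 1 and \<open>b\<close>, refuting both kinds of
    monotonicity.\<close>
  then have "\<not> eigenvalue_H T H m a \<le> eigenvalue_H T H m 1" "\<not> eigenvalue_H T H m 1 \<ge> eigenvalue_H T H m b"
    using a b by auto
  moreover have "C12per T m"
    unfolding m_def by (rule wave_C12per[OF assms(1) g(1) g_d g'_d g''_c])
  moreover have "a \<le> 1" "1 \<le> b" "0 < (1::real)" using a b by auto
  ultimately show ?thesis using a(1) by blast
qed

end
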